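(* Let $g_x^{(i)}, g_v^{(i)}$ and $\rho_{x,j}^{(i)},\rho_{v,j}^{(i)}$ ($i\in\{1,2\}$, $j\in\{-2,-1,1,2\}$) be real numbers with $\sum_{j\in\{\pm1,\pm2\}}\rho^{(i)}_{x,j}=-1$ and $\sum_{j\in\{\pm1,\pm2\}}\rho^{(i)}_{v,j}=-1$ for each $i$. For each $n$ let $\mathbf M=\mathbf M_n$ be the $4n\times 4n$ matrix of the two-type next nearest neighbor system with periodic boundary conditions with $N=2n$ vehicles (defined in the context). If any one of the following conditions is satisfied, then for all sufficiently large $N=2n$ the system $\frac{d}{dt}(\mathbf z,\dot{\mathbf z})^T=\mathbf M_n(\mathbf z,\dot{\mathbf z})^T$ is not linearly stable: (i) $g_x^{(1)}=0$ or $g_x^{(2)}=0$. (ii) $g_x^{(1)}\alpha_{x,1}^{(1)}+g_x^{(2)}\alpha_{x,1}^{(2)}\le 0$ or $g_v^{(1)}\alpha_{v,1}^{(1)}+g_v^{(2)}\alpha_{v,1}^{(2)}\le 0$. (iii) $g_x^{(1)}g_x^{(2)}\left[\alpha_{x,1}^{(2)}\big(\beta_{x,1}^{(1)}+2\beta_{x,2}^{(1)}\big)+\alpha_{x,1}^{(1)}\big(\beta_{x,1}^{(2)}+2\beta_{x,2}^{(2)}\big)\right]\neq 0$.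
   Context: Notation: for $r\in\{x,v\}$, $i\in\{1,2\}$, $j\in\{1,2\}$, $\alpha_{r,j}^{(i)}=\rho_{r,j}^{(i)}+\rho_{r,-j}^{(i)}$ and $\beta_{r,j}^{(i)}=\rho_{r,j}^{(i)}-\rho_{r,-j}^{(i)}$. The system: there are $n$ vehicles of each of two types, $N=2n$ in total, with $\mathbf z^{(i)}=(z^{(i)}_1,\dots,z^{(i)}_n)$ the deviations from equilibrium positions of the vehicles of type $i$. With indices $k$ taken modulo $n$ (periodic boundary conditions), the equations of motion are $$\ddot z^{(1)}_k=g^{(1)}_x\big(z^{(1)}_k+\rho^{(1)}_{x,1}z^{(2)}_k+\rho^{(1)}_{x,-1}z^{(2)}_{k-1}+\rho^{(1)}_{x,2}z^{(1)}_{k+1}+\rho^{(1)}_{x,-2}z^{(1)}_{k-1}\big)+g^{(1)}_v\big(\dot z^{(1)}_k+\rho^{(1)}_{v,1}\dot z^{(2)}_k+\rho^{(1)}_{v,-1}\dot z^{(2)}_{k-1}+\rho^{(1)}_{v,2}\dot z^{(1)}_{k+1}+\rho^{(1)}_{v,-2}\dot z^{(1)}_{k-1}\big),$$ $$\ddot z^{(2)}_k=g^{(2)}_x\big(z^{(2)}_k+\rho^{(2)}_{x,-1}z^{(1)}_k+\rho^{(2)}_{x,1}z^{(1)}_{k+1}+\rho^{(2)}_{x,-2}z^{(2)}_{k-1}+\rho^{(2)}_{x,2}z^{(2)}_{k+1}\big)+g^{(2)}_v\big(\dot z^{(2)}_k+\rho^{(2)}_{v,-1}\dot z^{(1)}_k+\rho^{(2)}_{v,1}\dot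 z^{(1)}_{k+1}+\rho^{(2)}_{v,-2}\dot z^{(2)}_{k-1}+\rho^{(2)}_{v,2}\dot z^{(2)}_{k+1}\big).$$ $\mathbf M_n$ is the $4n\times 4n$ matrix of the equivalent first-order linear system $\frac{d}{dt}(\mathbf z,\dot{\mathbf z})^T=\mathbf M_n(\mathbf z,\dot{\mathbf z})^T$ with $\mathbf z=(\mathbf z^{(1)},\mathbf z^{(2)})$. Linear stability: the system is called linearly stable if its matrix has the eigenvalue zero with geometric multiplicity one and algebraic multiplicity two, and all other eigenvalues have real part less than zero. *)

theory Defs
  imports "Jordan_Normal_Form.Matrix_Kernel" "Jordan_Normal_Form.Char_Poly" Complex_Main
begin

definition geom_mult :: "'a::field mat \<Rightarrow> 'a \<Rightarrow> nat" where
  "geom_mult A \<mu> = kernel_dim (char_matrix A \<mu>)"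

definition alg_mult :: "'a::field mat \<Rightarrow> 'a \<Rightarrow> nat" where
  "alg_mult A \<mu> = order \<mu> (char_poly A)"

(* Linear stability of the system x' = A x; the spectrum is the complex one. *)
definition linearly_stable :: "real mat \<Rightarrow> bool" where
  "linearly_stable A \<longleftrightarrow>
     (let B = map_mat complex_of_real A in
        eigenvalue B 0 \<and> geom_mult B 0 = 1 \<and> alg_mult B 0 = 2 \<and>
        (\<forall>\<mu>. eigenvalue B \<mu> \<and> \<mu> \<noteq> 0 \<longrightarrow> Re \<mu> < 0))"

(* Coupling coefficients are written \<rho> i j, where i = 1, 2 is the vehicle type and
   j = -2, -1, 1, 2 the relative position of the neighbour; \<alpha> and \<beta> below are used for j = 1, 2. *)
definition alpha :: "(nat \<Rightarrow> int \<Rightarrow> real) \<Rightarrow> nat \<Rightarrow> int \<Rightarrow> real" where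
  "alpha \<rho> i j = \<rho> i j + \<rho> i (- j)"

definition beta :: "(nat \<Rightarrow> int \<Rightarrow> real) \<Rightarrow> nat \<Rightarrow> int \<Rightarrow> real" where
  "beta \<rho> i j = \<rho> i j - \<rho> i (- j)"

(* Vehicles of each type are indexed by the residues 0, ..., n-1 modulo n. *)
definition succ_mod :: "nat \<Rightarrow> nat \<Rightarrow> nat" where
  "succ_mod n k = (k + 1) mod n"

definition pred_mod :: "nat \<Rightarrow> nat \<Rightarrow> nat" where
  "pred_mod n k = (k + n - 1) mod n"

(* The vehicles are interleaved in the order p 0, q 0, p 1, q 1, ..., where p and q hold the
   positions (or the velocities) of the vehicles of type 1 and 2. *)
definition coupling1 :: "(nat \<Rightarrow> int \<Rightarrow> real) \<Rightarrow> nat \<Rightarrow> (nat \<Rightarrow> real) \<Rightarrow> (nat \<Rightarrow> real) \<Rightarrow> nat \<Rightarrow> real" where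
  "coupling1 \<rho> n p q k =
     p k + \<rho> 1 1 * q k + \<rho> 1 (-1) * q (pred_mod n k)
         + \<rho> 1 2 * p (succ_mod n k) + \<rho> 1 (-2) * p (pred_mod n k)"

definition coupling2 :: "(nat \<Rightarrow> int \<Rightarrow> real) \<Rightarrow> nat \<Rightarrow> (nat \<Rightarrow> real) \<Rightarrow> (nat \<Rightarrow> real) \<Rightarrow> nat \<Rightarrow> real" where
  "coupling2 \<rho> n p q k =
     q k + \<rho> 2 (-1) * p k + \<rho> 2 1 * p (succ_mod n k)
         + \<rho> 2 (-2) * q (pred_mod n k) + \<rho> 2 2 * q (succ_mod n k)"

(* The right-hand side of the first-order system for the state
   w = (z1, z2, z1', z2'), each of the four blocks having length n. *)
definition motion_rhs ::
  "(nat \<Rightarrow> real) \<Rightarrow> (nat \<Rightarrow> real) \<Rightarrow> (nat \<Rightarrow> int \<Rightarrow> real) \<Rightarrow> (nat \<Rightarrow> int \<Rightarrow> real)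
     \<Rightarrow> nat \<Rightarrow> real vec \<Rightarrow> real vec" where
  "motion_rhs gx gv \<rho>x \<rho>v n w =
     (let z1 = (\<lambda>k. w $ k); z2 = (\<lambda>k. w $ (n + k));
          v1 = (\<lambda>k. w $ (2 * n + k)); v2 = (\<lambda>k. w $ (3 * n + k))
      in vec (4 * n) (\<lambda>r.
           if r < n then v1 r
           else if r < 2 * n then v2 (r - n)
           else if r < 3 * n then
             gx 1 * coupling1 \<rho>x n z1 z2 (r - 2 * n) + gv 1 * coupling1 \<rho>v n v1 v2 (r - 2 * n)
           else
             gx 2 * coupling2 \<rho>x n z1 z2 (r - 3 * n) + gv 2 * coupling2 \<rho>v n v1 v2 (r - 3 * n)))"

(* The matrix of the linear map motion_rhs: column c is the image of the c-th unit vector. *)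
definition system_matrix ::
  "(nat \<Rightarrow> real) \<Rightarrow> (nat \<Rightarrow> real) \<Rightarrow> (nat \<Rightarrow> int \<Rightarrow> real) \<Rightarrow> (nat \<Rightarrow> int \<Rightarrow> real)
     \<Rightarrow> nat \<Rightarrow> real mat" where
  "system_matrix gx gv \<rho>x \<rho>v n =
     mat (4 * n) (4 * n) (\<lambda>(r, c). motion_rhs gx gv \<rho>x \<rho>v n (unit_vec (4 * n) c) $ r)"

lemma system_matrix_carrier [simp]:
  "system_matrix gx gv \<rho>x \<rho>v n \<in> carrier_mat (4 * n) (4 * n)"
  by (simp add: system_matrix_def)

lemma system_matrix_mult_vec:
  assumes w: "w \<in> carrier_vec (4 * n)"
  shows "system_matrix gx gv \<rho>x \<rho>v n *\<^sub>v w = motion_rhs gx gv \<rho>x \<rho>v n w"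
proof (rule eq_vecI)
  fix r assume "r < dim_vec (motion_rhs gx gv \<rho>x \<rho>v n w)"
  then have r: "r < 4 * n" by (simp add: motion_rhs_def Let_def)
  then have n: "0 < n" by simp
  have s: "succ_mod n k < n" "pred_mod n k < n" for k
    using n by (simp_all add: succ_mod_def pred_mod_def)
  have comp: "w $ i = (\<Sum>c<4 * n. unit_vec (4 * n) c $ i * w $ c)" if "i < 4 * n" for i
    using that by (simp add: unit_vec_def if_distrib[of "\<lambda>x. x * _"] sum.delta cong: if_cong)
  have "(system_matrix gx gv \<rho>x \<rho>v n *\<^sub>v w) $ r
      = (\<Sum>c<4 * n. motion_rhs gx gv \<rho>x \<rho>v n (unit_vec (4 * n) c) $ r * w $ c)"
    using r w by (simp add: system_matrix_def scalar_prod_def lessThan_atLeast0)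
  also have "\<dots> = motion_rhs gx gv \<rho>x \<rho>v n w $ r"
  proof -
    let ?S = "\<lambda>i. (\<Sum>c<4 * n. unit_vec (4 * n) c $ i * w $ c)"
    have idx: "w $ k = ?S k" "w $ (n + k) = ?S (n + k)" "w $ (2 * n + k) = ?S (2 * n + k)"
      "w $ (3 * n + k) = ?S (3 * n + k)" if "k < n" for k
      by (rule comp; use that in simp)+
    note simps = motion_rhs_def Let_def coupling1_def coupling2_def s
      sum.distrib sum_distrib_left distrib_left distrib_right mult.assoc
    consider "r < n" | k where "r = n + k" "k < n" | k where "r = 2 * n + k" "k < n"
      | k where "r = 3 * n + k" "k < n"
    proof -
      consider "r < n" | "n \<le> r" "r < 2 * n" | "2 * n \<le> r" "r < 3 * n" | "3 * n \<le> r" by linarith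
      then show thesis
        by cases (use r that in \<open>auto simp: le_iff_add\<close>)
    qed
    then show ?thesis
    proof cases
      case 1
      then show ?thesis using r by (simp add: simps idx(3))
    next
      case (2 k)
      then show ?thesis using r by (simp add: simps idx(4))
    next
      case (3 k)
      then show ?thesis using r by (simp add: simps idx)
    next
      case (4 k)
      then show ?thesis using r by (simp add: simps idx)
    qed
  qed
  finally show "(system_matrix gx gv \<rho>x \<rho>v n *\<^sub>v w) $ r = motion_rhs gx gv \<rho>x \<rho>v n w $ r" .
qed (simp add: motion_rhs_def system_matrix_def Let_def)

end

theory Submission
  imports Defs "HOL-Computational_Algebra.Fundamental_Theorem_Algebra"
begin

text \<open>
  The translation-invariant system splits into Fourier modes: a vector whose blocks are multiples of
  \<open>\<omega>^k\<close>, where \<open>\<omega>^n = 1\<close>, is an eigenvector for \<open>\<nu>\<close> once \<open>\<nu>\<close> is a root of a monic quartic with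
  coefficients depending on \<open>\<omega>\<close>. For \<open>\<omega> = 1\<close> the quartic is \<open>\<nu>\<^sup>2 (\<nu>\<^sup>2 + Q \<nu> + P)\<close>, with \<open>P\<close> and \<open>Q\<close> the two
  sums in (ii). A nonpositive \<open>Q\<close> or negative \<open>P\<close> gives a nonzero eigenvalue in the closed right
  half-plane; if \<open>P = 0\<close>, the eigenvalue zero has a two-dimensional eigenspace or a Jordan chain of
  length three. Under (i), zero is a root of the quartic of every mode, so its eigenspace is too large.
  Under (iii), with \<open>\<omega> = cis t\<close> and \<open>t = 2 pi / n\<close>, the constant coefficient of the quartic is
  \<open>- \<i> K t / 2 + o(t)\<close> for the nonzero real \<open>K\<close> in (iii), and its linear coefficient is \<open>O(t)\<close>. Its small
  roots therefore behave like the square roots of \<open>\<i> K t / (2 P)\<close>, one of which has positive real part.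
\<close>

section \<open>Linear algebra and a root bound\<close>

text \<open>Row reduction multiplies by an invertible matrix and so keeps the kernel, and a finite
  basis can be read off the echelon form. Such a basis is what ties \<open>kernel_dim\<close> to a
  cardinality.\<close>

lemma (in kernel) finite_kernel_basis_exists: "\<exists>X. finite X \<and> basis X"
proof -
  from gauss_jordan_single[OF A refl]
  obtain P Q where C: "gauss_jordan_single A = P * A" and QP: "Q * P = 1\<^sub>m nr"
    and P: "P \<in> carrier_mat nr nr" and Q: "Q \<in> carrier_mat nr nr"
    and Cc: "gauss_jordan_single A \<in> carrier_mat nr nc"
    and row: "row_echelon_form (gauss_jordan_single A)" by auto
  have "mat_kernel (gauss_jordan_single A) = mat_kernel A"
    unfolding C by (rule mat_kernel_mult_eq[OF A P Q QP])
  then show ?thesis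
    using find_base_vectors(3)[OF row Cc] by (intro exI[of _ "set (find_base_vectors (gauss_jordan_single A))"]) auto
qed

text \<open>A basis of the eigenspace is a single vector \<open>u\<close>; since \<open>v\<close> is
  a nonzero multiple of \<open>u\<close>, every other eigenvector is a multiple of \<open>v\<close>.
  Two independent null vectors therefore refute stability.\<close>

lemma geom_mult_one_eigenvectors_proportional:
  assumes B: "B \<in> carrier_mat n n" and "geom_mult B \<mu> = 1"
    and v: "eigenvector B v \<mu>" and w: "eigenvector B w \<mu>"
  obtains c where "w = c \<cdot>\<^sub>v v"
proof -
  interpret kernel n n "char_matrix B \<mu>" by unfold_locales (use B in simp)
  obtain X where X: "finite X" "basis X" using finite_kernel_basis_exists by blast
  have "card X = 1"
    using assms(2) Ker.dim_basis[OF X] by (simp add: geom_mult_def)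
  then obtain u where u: "X = {u}" by (auto simp: card_1_singleton_iff)
  have uk: "u \<in> mat_kernel (char_matrix B \<mu>)" and sp: "span {u} = mat_kernel (char_matrix B \<mu>)"
    using X(2) by (auto simp: Ker.basis_def u)
  then have uc: "u \<in> carrier_vec n" using mat_kernelD[OF A] by blast
  have multiple: "\<exists>c. x = c \<cdot>\<^sub>v u" if "eigenvector B x \<mu>" for x
  proof -
    have "x \<in> mat_kernel (char_matrix B \<mu>)"
      using that eigenvector_char_matrix[OF B] mat_kernelI[OF A] by blast
    then have "x \<in> span {u}" using sp by simp
    then obtain a where "x = lincomb a {u}"
      using Ker.finite_span[of "{u}"] uk by auto
    then have "x = a u \<cdot>\<^sub>v u"
      using lincomb_index[of _ "{u}" a] uk uc mat_kernelD(1)[OF A]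
      by (intro eq_vecI) (auto simp: lincomb_index Ker.lincomb_def)
    then show ?thesis by blast
  qed
  obtain a b where ab: "v = a \<cdot>\<^sub>v u" "w = b \<cdot>\<^sub>v u" using multiple v w by blast
  have "a \<noteq> 0" using v uc B by (auto simp: ab eigenvector_def)
  then have "w = (b / a) \<cdot>\<^sub>v v" by (simp add: ab smult_smult_assoc)
  then show thesis by (rule that)
qed

text \<open>The polynomial vector \<open>u0 + x u1 + x\<^sup>2 u2\<close> is mapped by \<open>x - B\<close> to \<open>x\<^sup>3 u2\<close>; multiplying by the
  adjugate of \<open>x - B\<close> shows that \<open>x\<^sup>3\<close> divides the characteristic polynomial.\<close>

lemma jordan_chain_alg_mult_ge_3:
  fixes B :: "'a::field mat"
  assumes B: "B \<in> carrier_mat n n"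
    and u: "u0 \<in> carrier_vec n" "u1 \<in> carrier_vec n" "u2 \<in> carrier_vec n"
    and chain: "B *\<^sub>v u0 = 0\<^sub>v n" "B *\<^sub>v u1 = u0" "B *\<^sub>v u2 = u1" and "u0 \<noteq> 0\<^sub>v n"
  shows "3 \<le> alg_mult B 0"
proof -
  let ?X = "char_poly_matrix B"
  define U where "U = vec n (\<lambda>i. [:u0 $ i, u1 $ i, u2 $ i:])"
  define W where "W = vec n (\<lambda>i. [:u2 $ i:])"
  have X: "?X \<in> carrier_mat n n" using B by simp
  note adj = adj_mat[OF X]
  have U: "U \<in> carrier_vec n" and W: "W \<in> carrier_vec n" by (simp_all add: U_def W_def)
  \<comment> \<open>Scaling by \<open>x\<close> is written as a matrix, so that \<open>x - B\<close>
    can be applied to a vector as a sum of two matrices.\<close>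
  have ex: "[:0, 1:] \<cdot>\<^sub>v v = ([:0, 1:] \<cdot>\<^sub>m 1\<^sub>m n) *\<^sub>v v" if "v \<in> carrier_vec n" for v :: "'a poly vec"
    using that by (intro eq_vecI) (auto simp: smult_scalar_prod_distrib)
  have XU: "?X *\<^sub>v U = [:0, 0, 0, 1:] \<cdot>\<^sub>v W"
  proof (rule eq_vecI)
    fix i assume "i < dim_vec ([:0, 0, 0, 1:] \<cdot>\<^sub>v W)"
    then have i: "i < n" by (simp add: W_def)
    have row: "(\<Sum>j<n. B $$ (i, j) * u $ j) = (B *\<^sub>v u) $ i" if "u \<in> carrier_vec n" for u
      using that i B by (simp add: scalar_prod_def lessThan_atLeast0)
    have sum_pCons: "(\<Sum>j\<in>S. pCons (f j) (g j)) = pCons (sum f S) (sum g S)"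
      for f :: "nat \<Rightarrow> 'a" and g S by (induction S rule: infinite_finite_induct) auto
    have "(map_mat (\<lambda>a. [:- a:]) B *\<^sub>v U) $ i
        = (\<Sum>j<n. [:- B $$ (i, j):] * [:u0 $ j, u1 $ j, u2 $ j:])"
      using i B by (simp add: scalar_prod_def lessThan_atLeast0 U_def)
    also have "\<dots> = - [:(B *\<^sub>v u0) $ i, (B *\<^sub>v u1) $ i, (B *\<^sub>v u2) $ i:]"
      by (simp add: row[symmetric] u sum_pCons sum_negf mult.commute)
    also have "\<dots> = - [:0, u0 $ i, u1 $ i:]" using i by (simp add: chain)
    finally have m: "(map_mat (\<lambda>a. [:- a:]) B *\<^sub>v U) $ i = - [:0, u0 $ i, u1 $ i:]" .
    have "?X *\<^sub>v U = [:0, 1:] \<cdot>\<^sub>v U + map_mat (\<lambda>a. [:- a:]) B *\<^sub>v U"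
      using B U by (simp add: char_poly_matrix_def ex add_mult_distrib_mat_vec[of _ n n])
    then show "(?X *\<^sub>v U) $ i = ([:0, 0, 0, 1:] \<cdot>\<^sub>v W) $ i"
      using i B m by (simp add: U_def W_def)
  qed (use B in \<open>simp add: W_def char_poly_matrix_def\<close>)
  \<comment> \<open>At this index the entry of \<open>U\<close> has a nonzero constant term, so it
    absorbs no factor \<open>x\<close> and all three factors fall to the characteristic
    polynomial.\<close>
  obtain i where i: "i < n" "u0 $ i \<noteq> 0"
    using \<open>u0 \<noteq> 0\<^sub>v n\<close> u by (metis eq_vecI carrier_vecD index_zero_vec)
  have "char_poly B \<cdot>\<^sub>v U = (adj_mat ?X * ?X) *\<^sub>v U"
    unfolding adj char_poly_def using U by (intro eq_vecI) (auto simp: smult_scalar_prod_distrib)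
  also have "\<dots> = adj_mat ?X *\<^sub>v ([:0, 0, 0, 1:] \<cdot>\<^sub>v W)"
    using adj(1) X U by (simp add: assoc_mult_mat_vec XU)
  also have "\<dots> = [:0, 0, 0, 1:] \<cdot>\<^sub>v (adj_mat ?X *\<^sub>v W)"
    using adj(1) W by (intro eq_vecI) (auto simp: scalar_prod_smult_distrib[of _ n])
  finally have "(char_poly B \<cdot>\<^sub>v U) $ i = ([:0, 0, 0, 1:] \<cdot>\<^sub>v (adj_mat ?X *\<^sub>v W)) $ i" by simp
  then have eq: "char_poly B * U $ i = [:0, 0, 0, 1:] * (adj_mat ?X *\<^sub>v W) $ i"
    using i adj(1) U by simp
  have "[:0, 0, 0, 1:] = [:- 0, 1 :: 'a:] ^ 3" by (simp add: power3_eq_cube)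
  then have dvd: "[:- 0, 1:] ^ 3 dvd char_poly B * U $ i" using eq by (metis dvd_triv_left)
  have Ui: "poly (U $ i) 0 \<noteq> 0" using i by (simp add: U_def)
  moreover have "char_poly B \<noteq> 0" using degree_monic_char_poly[OF B] by auto
  ultimately have nz: "char_poly B * U $ i \<noteq> 0" by auto
  have "3 \<le> order 0 (char_poly B * U $ i)" using dvd nz order_divides by blast
  also have "\<dots> = order 0 (char_poly B)" using nz Ui by (simp add: order_mult order_0I)
  finally show ?thesis by (simp add: alg_mult_def)
qed

text \<open>This is the estimate \<open>|p' / p| \<le> \<Sum> 1 / |z - r| \<le> degree p / Re z\<close>, cleared of denominators.\<close>

lemma log_pderiv_bound:
  fixes p :: "complex poly"
  assumes "p \<noteq> 0" and "\<And>r. poly p r = 0 \<Longrightarrow> Re r \<le> 0" and "0 < Re z"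
  shows "Re z * cmod (poly (pderiv p) z) \<le> degree p * cmod (poly p z)"
  using assms(1,2)
proof (induction "degree p" arbitrary: p)
  case 0
  then have "pderiv p = 0" by (simp add: pderiv_eq_0_iff)
  then show ?case by simp
next
  case (Suc d)
  obtain r where r: "poly p r = 0"
    using fundamental_theorem_of_algebra[of p] Suc(2) by (auto simp: constant_degree)
  then obtain q where q: "p = [:- r, 1:] * q" by (metis poly_eq_0_iff_dvd dvdE)
  have q0: "q \<noteq> 0" using q Suc(3) by auto
  then have deg: "degree p = Suc (degree q)" unfolding q by (subst degree_mult_eq) auto
  have IH: "Re z * cmod (poly (pderiv q) z) \<le> degree q * cmod (poly q z)"
    using Suc(1)[of q] deg Suc(2) q0 Suc(4) by (auto simp: q)
  \<comment> \<open>The root \<open>r\<close> lies in the closed left half-plane, so its distance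
    from \<open>z\<close> is at least \<open>Re z\<close>.\<close>
  have le: "Re z \<le> cmod (z - r)"
    using Suc(4)[OF r] complex_Re_le_cmod[of "z - r"] by simp
  have "poly (pderiv p) z = poly q z + (z - r) * poly (pderiv q) z"
    unfolding q pderiv_mult by (simp add: pderiv_pCons algebra_simps)
  then have "Re z * cmod (poly (pderiv p) z)
      \<le> Re z * (cmod (poly q z) + cmod (z - r) * cmod (poly (pderiv q) z))"
    using assms(3) by (metis norm_mult norm_triangle_ineq mult_left_mono less_imp_le)
  also have "\<dots> = Re z * cmod (poly q z) + cmod (z - r) * (Re z * cmod (poly (pderiv q) z))"
    by (simp add: algebra_simps)
  \<comment> \<open>The bound on \<open>Re z\<close> serves the first summand, the induction
    hypothesis for the quotient \<open>q\<close> the second.\<close>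
  also have "\<dots> \<le> cmod (z - r) * cmod (poly q z) + cmod (z - r) * (degree q * cmod (poly q z))"
    using le IH by (intro add_mono mult_right_mono mult_left_mono) auto
  also have "\<dots> = degree p * cmod (poly p z)"
  proof -
    have "poly p z = (z - r) * poly q z" by (simp add: q algebra_simps)
    then show ?thesis by (simp add: deg norm_mult distrib_right)
  qed
  finally show ?case .
qed

section \<open>Fourier modes\<close>

text \<open>Fourier multipliers: on a sequence proportional to \<open>\<omega> ^ k\<close> passing
  to the successor multiplies by \<omega>, passing to the predecessor divides by it. The two cross
  symbols differ because type 1 couples to type 2 at \<open>k\<close> and \<open>k - 1\<close>, but
  type 2 to type 1 at \<open>k\<close> and \<open>k + 1\<close>.\<close>

definition self_symbol :: "(nat \<Rightarrow> int \<Rightarrow> real) \<Rightarrow> nat \<Rightarrow> complex \<Rightarrow> complex" where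
  "self_symbol \<rho> i \<omega> = 1 + of_real (\<rho> i 2) * \<omega> + of_real (\<rho> i (-2)) / \<omega>"

definition cross_symbol1 :: "(nat \<Rightarrow> int \<Rightarrow> real) \<Rightarrow> complex \<Rightarrow> complex" where
  "cross_symbol1 \<rho> \<omega> = of_real (\<rho> 1 1) + of_real (\<rho> 1 (-1)) / \<omega>"

definition cross_symbol2 :: "(nat \<Rightarrow> int \<Rightarrow> real) \<Rightarrow> complex \<Rightarrow> complex" where
  "cross_symbol2 \<rho> \<omega> = of_real (\<rho> 2 (-1)) + of_real (\<rho> 2 1) * \<omega>"

lemma unity_root_power_mod:
  fixes \<omega> :: "'a::monoid_mult"
  assumes "\<omega> ^ n = 1"
  shows "\<omega> ^ (k mod n) = \<omega> ^ k"
proof -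
  have "\<omega> ^ k = \<omega> ^ (n * (k div n) + k mod n)" by simp
  also have "\<dots> = \<omega> ^ (k mod n)" by (simp only: power_add power_mult assms) simp
  finally show ?thesis by simp
qed

lemma unity_root_succ_pred:
  fixes \<omega> :: complex
  assumes "\<omega> ^ n = 1" "0 < n"
  shows "\<omega> ^ succ_mod n k = \<omega> * \<omega> ^ k" "\<omega> ^ pred_mod n k = \<omega> ^ k / \<omega>"
proof -
  have "\<omega> \<noteq> 0" using assms by (auto simp: power_0_left)
  moreover have "\<omega> * \<omega> ^ (k + n - 1) = \<omega> ^ k"
    using assms by (simp flip: power_Suc add: power_add)
  ultimately show "\<omega> ^ succ_mod n k = \<omega> * \<omega> ^ k" "\<omega> ^ pred_mod n k = \<omega> ^ k / \<omega>"
    by (simp_all add: succ_mod_def pred_mod_def unity_root_power_mod[OF assms(1)] field_simps)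
qed

lemma succ_pred_mod_less:
  assumes "0 < n" shows "succ_mod n k < n" "pred_mod n k < n"
  using assms by (simp_all add: succ_mod_def pred_mod_def)

text \<open>The couplings act on real sequences, so a complex mode enters through \<open>F\<close>,
  its real or imaginary part. Only real linearity of \<open>F\<close> is needed to pull the
  multipliers out.\<close>

lemma coupling_mode:
  fixes F :: "complex \<Rightarrow> real"
  assumes "\<omega> ^ n = 1" "k < n" and F: "F = Re \<or> F = Im"
    and p: "\<And>k. k < n \<Longrightarrow> p k = F (a * \<omega> ^ k)" and q: "\<And>k. k < n \<Longrightarrow> q k = F (b * \<omega> ^ k)"
  shows "coupling1 \<rho> n p q k = F ((self_symbol \<rho> 1 \<omega> * a + cross_symbol1 \<rho> \<omega> * b) * \<omega> ^ k)"
    and "coupling2 \<rho> n p q k = F ((cross_symbol2 \<rho> \<omega> * a + self_symbol \<rho> 2 \<omega> * b) * \<omega> ^ k)"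
proof -
  have n: "0 < n" using assms(2) by simp
  have lin: "F (x + y) = F x + F y" "F (of_real c * x) = c * F x" for x y c using F by auto
  note s = unity_root_succ_pred[OF assms(1) n] succ_pred_mod_less[OF n]
  have "(self_symbol \<rho> 1 \<omega> * a + cross_symbol1 \<rho> \<omega> * b) * \<omega> ^ k
    = a * \<omega> ^ k + of_real (\<rho> 1 1) * (b * \<omega> ^ k) + of_real (\<rho> 1 (-1)) * (b * (\<omega> ^ k / \<omega>))
      + of_real (\<rho> 1 2) * (a * (\<omega> * \<omega> ^ k)) + of_real (\<rho> 1 (-2)) * (a * (\<omega> ^ k / \<omega>))"
    by (simp add: self_symbol_def cross_symbol1_def algebra_simps)
  then show "coupling1 \<rho> n p q k = F ((self_symbol \<rho> 1 \<omega> * a + cross_symbol1 \<rho> \<omega> * b) * \<omega> ^ k)"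
    by (simp only: lin) (simp add: coupling1_def s p q assms(2))
  have "(cross_symbol2 \<rho> \<omega> * a + self_symbol \<rho> 2 \<omega> * b) * \<omega> ^ k
    = b * \<omega> ^ k + of_real (\<rho> 2 (-1)) * (a * \<omega> ^ k) + of_real (\<rho> 2 1) * (a * (\<omega> * \<omega> ^ k))
      + of_real (\<rho> 2 (-2)) * (b * (\<omega> ^ k / \<omega>)) + of_real (\<rho> 2 2) * (b * (\<omega> * \<omega> ^ k))"
    by (simp add: self_symbol_def cross_symbol2_def algebra_simps)
  then show "coupling2 \<rho> n p q k = F ((cross_symbol2 \<rho> \<omega> * a + self_symbol \<rho> 2 \<omega> * b) * \<omega> ^ k)"
    by (simp only: lin) (simp add: coupling2_def s p q assms(2))
qed

section \<open>Mode vectors and the action of the system matrix on them\<close>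

definition mode :: "nat \<Rightarrow> complex \<Rightarrow> complex \<Rightarrow> complex \<Rightarrow> complex \<Rightarrow> complex \<Rightarrow> complex vec" where
  "mode n \<omega> a b c d = vec (4 * n) (\<lambda>r.
     if r < n then a * \<omega> ^ r
     else if r < 2 * n then b * \<omega> ^ (r - n)
     else if r < 3 * n then c * \<omega> ^ (r - 2 * n)
     else d * \<omega> ^ (r - 3 * n))"

lemma mode_carrier [simp]: "mode n \<omega> a b c d \<in> carrier_vec (4 * n)"
  and dim_mode [simp]: "dim_vec (mode n \<omega> a b c d) = 4 * n"
  by (simp_all add: mode_def)

lemma mode_index:
  assumes "k < n"
  shows "mode n \<omega> a b c d $ k = a * \<omega> ^ k" "mode n \<omega> a b c d $ (n + k) = b * \<omega> ^ k"
    "mode n \<omega> a b c d $ (2 * n + k) = c * \<omega> ^ k" "mode n \<omega> a b c d $ (3 * n + k) = d * \<omega> ^ k"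
  using assms by (simp_all add: mode_def)

lemma mode_eq_0_iff:
  assumes "0 < n"
  shows "mode n \<omega> a b c d = 0\<^sub>v (4 * n) \<longleftrightarrow> a = 0 \<and> b = 0 \<and> c = 0 \<and> d = 0"
proof
  assume *: "mode n \<omega> a b c d = 0\<^sub>v (4 * n)"
  have "mode n \<omega> a b c d $ r = 0" if "r < 4 * n" for r using that by (simp add: *)
  from this[of 0] this[of n] this[of "2 * n"] this[of "3 * n"] assms
  show "a = 0 \<and> b = 0 \<and> c = 0 \<and> d = 0" using mode_index[of 0 n] by simp
qed (auto simp: mode_def)

lemma smult_mode: "x \<cdot>\<^sub>v mode n \<omega> a b c d = mode n \<omega> (x * a) (x * b) (x * c) (x * d)"
  by (rule eq_vecI) (auto simp: mode_def)

text \<open>For each root of unity \<omega> the modes form an invariant space, on which the large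
  matrix acts as a map of the four amplitudes \<open>(a, b, c, d)\<close>.\<close>

lemma system_matrix_mult_mode:
  fixes gx gv \<rho>x \<rho>v
  assumes \<omega>: "\<omega> ^ n = 1"
  defines "B \<equiv> map_mat complex_of_real (system_matrix gx gv \<rho>x \<rho>v n)"
  shows "B *\<^sub>v mode n \<omega> a b c d = mode n \<omega> c d
    (of_real (gx 1) * (self_symbol \<rho>x 1 \<omega> * a + cross_symbol1 \<rho>x \<omega> * b)
      + of_real (gv 1) * (self_symbol \<rho>v 1 \<omega> * c + cross_symbol1 \<rho>v \<omega> * d))
    (of_real (gx 2) * (cross_symbol2 \<rho>x \<omega> * a + self_symbol \<rho>x 2 \<omega> * b)
      + of_real (gv 2) * (cross_symbol2 \<rho>v \<omega> * c + self_symbol \<rho>v 2 \<omega> * d))"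
    (is "_ = mode n \<omega> c d ?c ?d")
proof (rule eq_vecI)
  let ?w = "mode n \<omega> a b c d"
  fix r assume "r < dim_vec (mode n \<omega> c d ?c ?d)"
  then have r: "r < 4 * n" by (simp add: mode_def)
  \<comment> \<open>The matrix is real, so it commutes with taking real and imaginary parts, and the
    real description by \<open>motion_rhs\<close> applies to each part.\<close>
  have "F ((B *\<^sub>v ?w) $ r) = F (mode n \<omega> c d ?c ?d $ r)" if F: "F = Re \<or> F = Im" for F
  proof -
    have lin: "F (x + y) = F x + F y" "F (of_real e * x) = e * F x" for x y e using F by auto
    have Fsum: "F (sum f S) = (\<Sum>x\<in>S. F (f x))" for f :: "nat \<Rightarrow> complex" and S using F by auto
    have Fw: "map_vec F ?w \<in> carrier_vec (4 * n)" by simp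
    have ix: "map_vec F ?w $ k = F (a * \<omega> ^ k)" "map_vec F ?w $ (n + k) = F (b * \<omega> ^ k)"
      "map_vec F ?w $ (2 * n + k) = F (c * \<omega> ^ k)" "map_vec F ?w $ (3 * n + k) = F (d * \<omega> ^ k)"
      if "k < n" for k
      using that mode_index[OF that, of \<omega> a b c d]
      by simp_all
    have "F ((B *\<^sub>v ?w) $ r) = (system_matrix gx gv \<rho>x \<rho>v n *\<^sub>v map_vec F ?w) $ r"
      using r
      by (simp add: B_def system_matrix_def scalar_prod_def Fsum lin)
    also have "\<dots> = motion_rhs gx gv \<rho>x \<rho>v n (map_vec F ?w) $ r"
      by (simp only: system_matrix_mult_vec[OF Fw])
    also have "\<dots> = F (mode n \<omega> c d ?c ?d $ r)"
    proof -
      consider "r < n" | k where "r = n + k" "k < n" | k where "r = 2 * n + k" "k < n"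
        | k where "r = 3 * n + k" "k < n"
      proof -
        consider "r < n" | "n \<le> r" "r < 2 * n" | "2 * n \<le> r" "r < 3 * n" | "3 * n \<le> r" by linarith
        then show thesis by cases (use r that in \<open>auto simp: le_iff_add\<close>)
      qed
      then show ?thesis
      proof cases
        case 1
        then show ?thesis by (simp add: motion_rhs_def Let_def mode_index ix)
      next
        case (2 k)
        then show ?thesis by (simp add: motion_rhs_def Let_def mode_index ix)
      next
        case (3 k)
        have x: "coupling1 \<rho>x n (\<lambda>k. map_vec F ?w $ k) (\<lambda>k. map_vec F ?w $ (n + k)) k
          = F ((self_symbol \<rho>x 1 \<omega> * a + cross_symbol1 \<rho>x \<omega> * b) * \<omega> ^ k)"
          by (rule coupling_mode[OF \<omega> 3(2) F]) (simp_all only: ix)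
        have v: "coupling1 \<rho>v n (\<lambda>k. map_vec F ?w $ (2 * n + k)) (\<lambda>k. map_vec F ?w $ (3 * n + k)) k
          = F ((self_symbol \<rho>v 1 \<omega> * c + cross_symbol1 \<rho>v \<omega> * d) * \<omega> ^ k)"
          by (rule coupling_mode[OF \<omega> 3(2) F]) (simp_all only: ix)
        have "motion_rhs gx gv \<rho>x \<rho>v n (map_vec F ?w) $ r
          = F (of_real (gx 1) * ((self_symbol \<rho>x 1 \<omega> * a + cross_symbol1 \<rho>x \<omega> * b) * \<omega> ^ k)
            + of_real (gv 1) * ((self_symbol \<rho>v 1 \<omega> * c + cross_symbol1 \<rho>v \<omega> * d) * \<omega> ^ k))"
          unfolding lin using 3 r by (simp add: motion_rhs_def Let_def x v)
        also have "\<dots> = F (mode n \<omega> c d ?c ?d $ r)"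
          using 3 by (simp only: mode_index) (simp add: algebra_simps)
        finally show ?thesis .
      next
        case (4 k)
        have x: "coupling2 \<rho>x n (\<lambda>k. map_vec F ?w $ k) (\<lambda>k. map_vec F ?w $ (n + k)) k
          = F ((cross_symbol2 \<rho>x \<omega> * a + self_symbol \<rho>x 2 \<omega> * b) * \<omega> ^ k)"
          by (rule coupling_mode[OF \<omega> 4(2) F]) (simp_all only: ix)
        have v: "coupling2 \<rho>v n (\<lambda>k. map_vec F ?w $ (2 * n + k)) (\<lambda>k. map_vec F ?w $ (3 * n + k)) k
          = F ((cross_symbol2 \<rho>v \<omega> * c + self_symbol \<rho>v 2 \<omega> * d) * \<omega> ^ k)"
          by (rule coupling_mode[OF \<omega> 4(2) F]) (simp_all only: ix)
        have "motion_rhs gx gv \<rho>x \<rho>v n (map_vec F ?w) $ r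
          = F (of_real (gx 2) * ((cross_symbol2 \<rho>x \<omega> * a + self_symbol \<rho>x 2 \<omega> * b) * \<omega> ^ k)
            + of_real (gv 2) * ((cross_symbol2 \<rho>v \<omega> * c + self_symbol \<rho>v 2 \<omega> * d) * \<omega> ^ k))"
          unfolding lin using 4 r by (simp add: motion_rhs_def Let_def x v)
        also have "\<dots> = F (mode n \<omega> c d ?c ?d $ r)"
          using 4 by (simp only: mode_index) (simp add: algebra_simps)
        finally show ?thesis .
      qed
    qed
    finally show ?thesis .
  qed
  then show "(B *\<^sub>v ?w) $ r = mode n \<omega> c d ?c ?d $ r" by (simp add: complex_eq_iff)
qed (simp add: B_def mode_def system_matrix_def)

text \<open>With velocity amplitudes \<open>\<nu> * a\<close> and \<open>\<nu> * b\<close>, the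
  eigenvalue equation becomes a 2x2 system for \<open>(a, b)\<close>, quadratic in \<nu>. This is
  its determinant; the signs of the two off-diagonal entries cancel in their product.\<close>

definition mode_poly ::
  "(nat \<Rightarrow> real) \<Rightarrow> (nat \<Rightarrow> real) \<Rightarrow> (nat \<Rightarrow> int \<Rightarrow> real) \<Rightarrow> (nat \<Rightarrow> int \<Rightarrow> real) \<Rightarrow> complex \<Rightarrow> complex poly"
  where
  "mode_poly gx gv \<rho>x \<rho>v \<omega> =
     [:- of_real (gx 1) * self_symbol \<rho>x 1 \<omega>, - of_real (gv 1) * self_symbol \<rho>v 1 \<omega>, 1:]
     * [:- of_real (gx 2) * self_symbol \<rho>x 2 \<omega>, - of_real (gv 2) * self_symbol \<rho>v 2 \<omega>, 1:]
     - [:of_real (gx 1) * cross_symbol1 \<rho>x \<omega>, of_real (gv 1) * cross_symbol1 \<rho>v \<omega>:]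
     * [:of_real (gx 2) * cross_symbol2 \<rho>x \<omega>, of_real (gv 2) * cross_symbol2 \<rho>v \<omega>:]"

text \<open>A nonzero row of the singular system determines a kernel vector, which the vanishing
  determinant makes a solution of the other row; if both rows vanish, any vector will do.\<close>

lemma singular_2x2_kernel:
  fixes p q r s :: "'a::field"
  assumes "p * s = q * r"
  obtains a b where "a \<noteq> 0 \<or> b \<noteq> 0" "p * a = q * b" "s * b = r * a"
proof -
  consider "p \<noteq> 0 \<or> q \<noteq> 0" | "p = 0" "q = 0" "r \<noteq> 0 \<or> s \<noteq> 0" | "p = 0" "q = 0" "r = 0" "s = 0"
    by blast
  then show thesis
  proof cases
    case 1
    then show thesis using that[of q p] assms by (simp add: mult.commute disj_commute)
  next
    case 2
    then show thesis using that[of s r] by (simp add: mult.commute disj_commute)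
  next
    case 3
    then show thesis using that[of 1 0] by simp
  qed
qed

text \<open>A kernel vector \<open>(a, b)\<close> of the singular 2x2 system solves the two
  acceleration blocks; the choice of velocity amplitudes solves the other two.\<close>

lemma mode_poly_root_eigenvector:
  assumes "\<omega> ^ n = 1" "0 < n" and root: "poly (mode_poly gx gv \<rho>x \<rho>v \<omega>) \<nu> = 0"
  obtains a b where "a \<noteq> 0 \<or> b \<noteq> 0"
    "eigenvector (map_mat complex_of_real (system_matrix gx gv \<rho>x \<rho>v n)) (mode n \<omega> a b (\<nu> * a) (\<nu> * b)) \<nu>"
proof -
  let ?p = "\<nu> * \<nu> - of_real (gx 1) * self_symbol \<rho>x 1 \<omega> - \<nu> * (of_real (gv 1) * self_symbol \<rho>v 1 \<omega>)"
  let ?s = "\<nu> * \<nu> - of_real (gx 2) * self_symbol \<rho>x 2 \<omega> - \<nu> * (of_real (gv 2) * self_symbol \<rho>v 2 \<omega>)"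
  let ?q = "of_real (gx 1) * cross_symbol1 \<rho>x \<omega> + \<nu> * (of_real (gv 1) * cross_symbol1 \<rho>v \<omega>)"
  let ?r = "of_real (gx 2) * cross_symbol2 \<rho>x \<omega> + \<nu> * (of_real (gv 2) * cross_symbol2 \<rho>v \<omega>)"
  have "poly (mode_poly gx gv \<rho>x \<rho>v \<omega>) \<nu> = ?p * ?s - ?q * ?r"
    by (simp add: mode_poly_def algebra_simps)
  then have "?p * ?s = ?q * ?r" using root by simp
  then obtain a b where ab: "a \<noteq> 0 \<or> b \<noteq> 0" "?p * a = ?q * b" "?s * b = ?r * a"
    by (rule singular_2x2_kernel)
  have 1: "of_real (gx 1) * (self_symbol \<rho>x 1 \<omega> * a + cross_symbol1 \<rho>x \<omega> * b)
      + of_real (gv 1) * (self_symbol \<rho>v 1 \<omega> * (\<nu> * a) + cross_symbol1 \<rho>v \<omega> * (\<nu> * b)) = \<nu> * (\<nu> * a)"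
    using ab(2) by (simp add: algebra_simps)
  have 2: "of_real (gx 2) * (cross_symbol2 \<rho>x \<omega> * a + self_symbol \<rho>x 2 \<omega> * b)
      + of_real (gv 2) * (cross_symbol2 \<rho>v \<omega> * (\<nu> * a) + self_symbol \<rho>v 2 \<omega> * (\<nu> * b)) = \<nu> * (\<nu> * b)"
    using ab(3) by (simp add: algebra_simps)
  have "eigenvector (map_mat complex_of_real (system_matrix gx gv \<rho>x \<rho>v n)) (mode n \<omega> a b (\<nu> * a) (\<nu> * b)) \<nu>"
    using ab(1) assms(2) unfolding eigenvector_def system_matrix_mult_mode[OF assms(1)] 1 2
    by (auto simp: smult_mode mode_eq_0_iff system_matrix_def)
  with ab(1) show thesis by (rule that)
qed

lemma linearly_stable_mode_poly_root:
  assumes "linearly_stable (system_matrix gx gv \<rho>x \<rho>v n)" "\<omega> ^ n = 1" "0 < n"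
    "poly (mode_poly gx gv \<rho>x \<rho>v \<omega>) \<nu> = 0"
  shows "\<nu> = 0 \<or> Re \<nu> < 0"
  using mode_poly_root_eigenvector[OF assms(2-4)] assms(1)
  by (metis eigenvalue_def linearly_stable_def)

section \<open>Conditions (i) and (ii)\<close>

lemma sum_neighbours:
  "(\<Sum>j\<in>{-2, -1, 1, 2}. \<rho> j) = \<rho> (-2) + \<rho> (-1) + \<rho> 1 + (\<rho> 2 :: real)" for \<rho> :: "int \<Rightarrow> real"
  by simp

lemma symbols_at_1:
  shows "(\<Sum>j\<in>{-2, -1, 1, 2}. \<rho> i j) = -1 \<Longrightarrow> self_symbol \<rho> i 1 = - of_real (alpha \<rho> i 1)"
    and "cross_symbol1 \<rho> 1 = of_real (alpha \<rho> 1 1)"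
    and "cross_symbol2 \<rho> 1 = of_real (alpha \<rho> 2 1)"
proof -
  assume "(\<Sum>j\<in>{-2, -1, 1, 2}. \<rho> i j) = -1"
  then have "1 + \<rho> i 2 + \<rho> i (-2) = - alpha \<rho> i 1" unfolding sum_neighbours alpha_def by linarith
  then show "self_symbol \<rho> i 1 = - of_real (alpha \<rho> i 1)"
    by (simp add: self_symbol_def complex_eq_iff)
qed (simp_all add: cross_symbol1_def cross_symbol2_def alpha_def)

text \<open>Take \<open>(- Q + r) / 2\<close> with \<open>r\<close> the principal square root of the
  discriminant. Then \<open>Q \<le> Re r\<close>: for nonpositive \<open>Q\<close> because
  \<open>0 \<le> Re r\<close>, and for negative \<open>P\<close> because the discriminant exceeds
  \<open>Q^2\<close>.\<close>

lemma quadratic_root_nonneg: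
  fixes P Q :: real
  assumes "P < 0 \<or> Q \<le> 0"
  obtains \<nu> :: complex where "\<nu> ^ 2 + of_real Q * \<nu> + of_real P = 0" "0 \<le> Re \<nu>"
proof
  define r where "r = csqrt (of_real (Q^2 - 4 * P))"
  have r2: "r ^ 2 = of_real (Q^2 - 4 * P)" by (simp add: r_def)
  show "((- of_real Q + r) / 2) ^ 2 + of_real Q * ((- of_real Q + r) / 2) + of_real P = 0"
  proof -
    have "((- of_real Q + r) / 2) ^ 2 + of_real Q * ((- of_real Q + r) / 2) + of_real P
        = (r ^ 2 - of_real (Q^2 - 4 * P)) / 4"
      by (simp add: field_simps power2_eq_square)
    then show ?thesis by (simp only: r2) simp
  qed
  have "Q \<le> Re r"
  proof (cases "Q \<le> 0")
    case True
    then show ?thesis using csqrt_principal[of "of_real (Q^2 - 4 * P)", folded r_def] by auto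
  next
    case False
    then have "Q\<^sup>2 \<le> Q^2 - 4 * P" using assms by simp
    then have "Q \<le> sqrt (Q^2 - 4 * P)" by (rule real_le_rsqrt)
    moreover have "0 \<le> Q^2 - 4 * P" using \<open>Q\<^sup>2 \<le> Q^2 - 4 * P\<close> zero_le_power2[of Q] by linarith
    then have "r = of_real (sqrt (Q^2 - 4 * P))" unfolding r_def by (subst csqrt_of_real_nonneg) auto
    ultimately show ?thesis by simp
  qed
  then show "0 \<le> Re ((- of_real Q + r) / 2)" by simp
qed

context
  fixes gx gv :: "nat \<Rightarrow> real" and \<rho>x \<rho>v :: "nat \<Rightarrow> int \<Rightarrow> real"
  assumes sum_x: "\<And>i. i \<in> {1, 2} \<Longrightarrow> (\<Sum>j\<in>{-2, -1, 1, 2}. \<rho>x i j) = -1"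
    and sum_v: "\<And>i. i \<in> {1, 2} \<Longrightarrow> (\<Sum>j\<in>{-2, -1, 1, 2}. \<rho>v i j) = -1"
begin

lemma self_symbols_at_1:
  "self_symbol \<rho>x 1 1 = - of_real (alpha \<rho>x 1 1)" "self_symbol \<rho>x 2 1 = - of_real (alpha \<rho>x 2 1)"
  "self_symbol \<rho>v 1 1 = - of_real (alpha \<rho>v 1 1)" "self_symbol \<rho>v 2 1 = - of_real (alpha \<rho>v 2 1)"
  by (rule symbols_at_1(1), rule sum_x sum_v, simp)+

text \<open>At \<omega> = 1 each self symbol is minus the cross symbol of its row, so accelerations
  depend only on differences between the two types.\<close>

lemma system_matrix_mult_constant_mode:
  "map_mat complex_of_real (system_matrix gx gv \<rho>x \<rho>v n) *\<^sub>v mode n 1 a b c d = mode n 1 c d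
    (of_real (gx 1 * alpha \<rho>x 1 1) * (b - a) + of_real (gv 1 * alpha \<rho>v 1 1) * (d - c))
    (of_real (gx 2 * alpha \<rho>x 2 1) * (a - b) + of_real (gv 2 * alpha \<rho>v 2 1) * (c - d))"
proof -
  have "map_mat complex_of_real (system_matrix gx gv \<rho>x \<rho>v n) *\<^sub>v mode n 1 a b c d = mode n 1 c d x y"
    if "x = of_real (gx 1) * (self_symbol \<rho>x 1 1 * a + cross_symbol1 \<rho>x 1 * b)
      + of_real (gv 1) * (self_symbol \<rho>v 1 1 * c + cross_symbol1 \<rho>v 1 * d)"
      "y = of_real (gx 2) * (cross_symbol2 \<rho>x 1 * a + self_symbol \<rho>x 2 1 * b)
      + of_real (gv 2) * (cross_symbol2 \<rho>v 1 * c + self_symbol \<rho>v 2 1 * d)" for x y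
    unfolding that by (rule system_matrix_mult_mode) simp
  then show ?thesis
    by this (simp_all add: self_symbols_at_1 symbols_at_1(2,3) algebra_simps del: One_nat_def)
qed

text \<open>Both diagonal entries are \<nu> squared plus the linear factor that also occurs off the
  diagonal, and the product of the two linear factors cancels.\<close>

lemma poly_mode_poly_1:
  "poly (mode_poly gx gv \<rho>x \<rho>v 1) \<nu> =
     \<nu> ^ 2 * (\<nu> ^ 2 + of_real (gv 1 * alpha \<rho>v 1 1 + gv 2 * alpha \<rho>v 2 1) * \<nu>
             + of_real (gx 1 * alpha \<rho>x 1 1 + gx 2 * alpha \<rho>x 2 1))"
proof -
  define p1 q1 p2 q2 where "p1 = complex_of_real (gx 1 * alpha \<rho>x 1 1)" "q1 = complex_of_real (gv 1 * alpha \<rho>v 1 1)"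
    "p2 = complex_of_real (gx 2 * alpha \<rho>x 2 1)" "q2 = complex_of_real (gv 2 * alpha \<rho>v 2 1)"
  note pq = this
  have "mode_poly gx gv \<rho>x \<rho>v 1 = [:p1, q1, 1:] * [:p2, q2, 1:] - [:p1, q1:] * [:p2, q2:]"
    unfolding mode_poly_def self_symbols_at_1 symbols_at_1(2,3) pq by simp
  then have "poly (mode_poly gx gv \<rho>x \<rho>v 1) \<nu> = \<nu> ^ 2 * (\<nu> ^ 2 + (q1 + q2) * \<nu> + (p1 + p2))"
    by (simp add: power2_eq_square algebra_simps)
  then show ?thesis by (simp only: pq of_real_add)
qed

text \<open>Shifting all vehicles by the same amount creates no force.\<close>

lemma constant_mode_kernel:
  assumes "0 < n"
  shows "eigenvector (map_mat complex_of_real (system_matrix gx gv \<rho>x \<rho>v n)) (mode n 1 1 1 0 0) 0"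
proof -
  have "map_mat complex_of_real (system_matrix gx gv \<rho>x \<rho>v n) *\<^sub>v mode n 1 1 1 0 0 = mode n 1 0 0 0 0"
    by (simp only: system_matrix_mult_constant_mode) simp
  then show ?thesis
    using assms by (simp add: eigenvector_def smult_mode) (simp add: system_matrix_def mode_eq_0_iff)
qed

lemma not_stable_if_uncoupled:
  assumes "gx 1 = 0 \<or> gx 2 = 0" "3 \<le> n"
  shows "\<not> linearly_stable (system_matrix gx gv \<rho>x \<rho>v n)"
proof
  let ?B = "map_mat complex_of_real (system_matrix gx gv \<rho>x \<rho>v n)"
  assume "linearly_stable (system_matrix gx gv \<rho>x \<rho>v n)"
  then have g: "geom_mult ?B 0 = 1" by (simp add: linearly_stable_def Let_def)
  define \<omega> where "\<omega> = cis (2 * pi / n)"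
  have n: "0 < n" using assms(2) by simp
  have w1: "\<omega> ^ n = 1" using n by (simp add: \<omega>_def DeMoivre)
  \<comment> \<open>From \<open>3 \<le> n\<close> the angle lies strictly between 0 and pi, so
    \<omega> is not real.\<close>
  have "2 * pi / n < pi" using assms(2) pi_gt_zero by (simp add: divide_less_eq)
  then have "0 < Im \<omega>" using n by (simp add: \<omega>_def sin_gt_zero)
  then have w: "\<omega> \<noteq> 1" by auto
  have "poly (mode_poly gx gv \<rho>x \<rho>v \<omega>) 0 = 0" using assms(1) by (auto simp: mode_poly_def)
  from mode_poly_root_eigenvector[OF w1 n this] obtain a b
    where ab: "a \<noteq> 0 \<or> b \<noteq> 0" "eigenvector ?B (mode n \<omega> a b 0 0) 0" by auto
  from geom_mult_one_eigenvectors_proportional[OF _ g constant_mode_kernel[OF n] ab(2)]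
  obtain c where c: "mode n \<omega> a b 0 0 = c \<cdot>\<^sub>v mode n 1 1 1 0 0"
    by (metis map_carrier_mat system_matrix_carrier)
  \<comment> \<open>Comparing the entries for \<open>k = 0\<close> and \<open>k = 1\<close> forces
    \<open>a = b = 0\<close>, because \<omega> differs from 1.\<close>
  have "a * \<omega> ^ k = c" "b * \<omega> ^ k = c" if "k < n" for k
    using arg_cong[OF c, of "\<lambda>v. v $ k"] arg_cong[OF c, of "\<lambda>v. v $ (n + k)"] that
    by (simp_all add: smult_mode mode_index)
  from this[of 0] this[of 1] assms(2) w ab(1) show False by auto
qed

lemma not_stable_if_nonpos:
  assumes "gx 1 * alpha \<rho>x 1 1 + gx 2 * alpha \<rho>x 2 1 \<le> 0 \<or> gv 1 * alpha \<rho>v 1 1 + gv 2 * alpha \<rho>v 2 1 \<le> 0"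
    (is "?P \<le> 0 \<or> ?Q \<le> 0")
    and n: "0 < n"
  shows "\<not> linearly_stable (system_matrix gx gv \<rho>x \<rho>v n)"
proof
  let ?B = "map_mat complex_of_real (system_matrix gx gv \<rho>x \<rho>v n)"
  have B: "?B \<in> carrier_mat (4 * n) (4 * n)" by simp
  assume stable: "linearly_stable (system_matrix gx gv \<rho>x \<rho>v n)"
  then have g: "geom_mult ?B 0 = 1" and alg: "alg_mult ?B 0 = 2"
    by (simp_all add: linearly_stable_def Let_def)
  define p where "p = complex_of_real (gx 1 * alpha \<rho>x 1 1)"
  consider "?P = 0" "p = 0" | "?P = 0" "p \<noteq> 0" | "?P \<noteq> 0" by blast
  then show False
  proof cases
    case 1
    then have z: "complex_of_real (gx 1 * alpha \<rho>x 1 1) = 0" "complex_of_real (gx 2 * alpha \<rho>x 2 1) = 0"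
      by (auto simp: p_def)
    \<comment> \<open>No static force acts between uniform shifts of the two types, so shifting type
      1 alone gives a second independent null vector.\<close>
    have "?B *\<^sub>v mode n 1 1 0 0 0 = mode n 1 0 0 0 0"
      by (simp only: system_matrix_mult_constant_mode z) simp
    then have "eigenvector ?B (mode n 1 1 0 0 0) 0"
      using n by (simp add: eigenvector_def smult_mode) (simp add: system_matrix_def mode_eq_0_iff)
    from geom_mult_one_eigenvectors_proportional[OF B g constant_mode_kernel[OF n] this]
    obtain c where c: "mode n 1 1 0 0 0 = c \<cdot>\<^sub>v mode n 1 1 1 0 0" .
    show False
      using arg_cong[OF c, of "\<lambda>v. v $ 0"] arg_cong[OF c, of "\<lambda>v. v $ (n + 0)"] n
      unfolding smult_mode mode_index[OF n] mode_index(2)[OF n] by simp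
  next
    case 2
    have "gx 2 * alpha \<rho>x 2 1 = - (gx 1 * alpha \<rho>x 1 1)" using 2(1) by linarith
    then have p2: "complex_of_real (gx 2 * alpha \<rho>x 2 1) = - p" by (simp only: p_def of_real_minus)
    note mult = system_matrix_mult_constant_mode[of n, folded p_def, unfolded p2]
    have "3 \<le> alg_mult ?B 0"
    proof (rule jordan_chain_alg_mult_ge_3[OF B])
      show "?B *\<^sub>v mode n 1 1 1 0 0 = 0\<^sub>v (4 * n)" using n by (simp add: mult mode_eq_0_iff)
      show "?B *\<^sub>v mode n 1 0 0 1 1 = mode n 1 1 1 0 0" by (simp add: mult)
      \<comment> \<open>The chain consists of a uniform shift, a uniform velocity and a relative
        displacement. The static coefficients being opposite, the displacement \<open>1 / p\<close>
        accelerates both types by 1.\<close>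
      show "?B *\<^sub>v mode n 1 0 (1 / p) 0 0 = mode n 1 0 0 1 1" using 2(2) by (simp add: mult)
      show "mode n 1 1 1 0 0 \<noteq> 0\<^sub>v (4 * n)" using n by (simp add: mode_eq_0_iff)
    qed simp_all
    then show False using alg by simp
  next
    case 3
    with assms(1) have "?P < 0 \<or> ?Q \<le> 0" by linarith
    then obtain \<nu> where \<nu>: "\<nu> ^ 2 + of_real ?Q * \<nu> + of_real ?P = 0" "0 \<le> Re \<nu>"
      by (rule quadratic_root_nonneg)
    then have "poly (mode_poly gx gv \<rho>x \<rho>v 1) \<nu> = 0" by (simp only: poly_mode_poly_1) simp
    from linearly_stable_mode_poly_root[OF stable _ n this] \<nu>(2) have "\<nu> = 0" by simp
    with \<nu>(1) 3 show False by (simp flip: of_real_add of_real_mult)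
  qed
qed

end

section \<open>Condition (iii)\<close>

text \<open>The determinant of the 2x2 symbol matrix with first row from \<sigma> and second row
  from \<tau>. Expanding the mode determinant row by row into position and velocity parts yields
  these terms.\<close>

definition mixed_det ::
  "(nat \<Rightarrow> int \<Rightarrow> real) \<Rightarrow> (nat \<Rightarrow> int \<Rightarrow> real) \<Rightarrow> complex \<Rightarrow> complex" where
  "mixed_det \<sigma> \<tau> \<omega> =
     self_symbol \<sigma> 1 \<omega> * self_symbol \<tau> 2 \<omega> - cross_symbol1 \<sigma> \<omega> * cross_symbol2 \<tau> \<omega>"

lemma mode_poly_coeffs:
  "mode_poly gx gv \<rho>x \<rho>v \<omega> =
     [:of_real (gx 1 * gx 2) * mixed_det \<rho>x \<rho>x \<omega>,
       of_real (gx 1 * gv 2) * mixed_det \<rho>x \<rho>v \<omega> + of_real (gv 1 * gx 2) * mixed_det \<rho>v \<rho>x \<omega>,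
       of_real (gv 1 * gv 2) * mixed_det \<rho>v \<rho>v \<omega>
         - of_real (gx 1) * self_symbol \<rho>x 1 \<omega> - of_real (gx 2) * self_symbol \<rho>x 2 \<omega>,
       - of_real (gv 1) * self_symbol \<rho>v 1 \<omega> - of_real (gv 2) * self_symbol \<rho>v 2 \<omega>,
       1:]"
  by (simp add: mode_poly_def mixed_det_def algebra_simps)

section \<open>First-order behaviour of the symbols at small angles\<close>

lemma cis_difference_quotient:
  "((\<lambda>t. (cis t - 1) / of_real t) \<longlongrightarrow> \<i>) (at_right 0)"
  "((\<lambda>t. (1 / cis t - 1) / of_real t) \<longlongrightarrow> - \<i>) (at_right 0)"
proof -
  have s: "((\<lambda>t. sin t / t) \<longlongrightarrow> (1::real)) (at_right 0)"
    using tendsto_within_subset[OF DERIV_D[OF DERIV_sin[of "0::real"]], of "{0<..}"] by simp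
  have c: "((\<lambda>t. (cos t - 1) / t) \<longlongrightarrow> (0::real)) (at_right 0)"
    using tendsto_within_subset[OF DERIV_D[OF DERIV_cos[of "0::real"]], of "{0<..}"] by simp
  have "((\<lambda>t. Complex ((cos t - 1) / t) (sin t / t)) \<longlongrightarrow> Complex 0 1) (at_right 0)"
    by (intro tendsto_Complex s c)
  moreover have "Complex ((cos t - 1) / t) (sin t / t) = (cis t - 1) / of_real t" for t
    by (simp add: complex_eq_iff)
  ultimately show "((\<lambda>t. (cis t - 1) / of_real t) \<longlongrightarrow> \<i>) (at_right 0)"
    by (simp flip: imaginary_unit.code)
  have "((\<lambda>t. Complex ((cos t - 1) / t) (- (sin t / t))) \<longlongrightarrow> Complex 0 (- 1)) (at_right 0)"
    by (intro tendsto_Complex tendsto_minus s c)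
  moreover have "Complex ((cos t - 1) / t) (- (sin t / t)) = (1 / cis t - 1) / of_real t" for t
  proof -
    have "1 / cis t = cis (- t)" by (simp add: inverse_eq_divide flip: cis_inverse)
    then show ?thesis by (simp add: complex_eq_iff)
  qed
  moreover have "Complex 0 (- 1) = - \<i>" by (simp add: complex_eq_iff)
  ultimately show "((\<lambda>t. (1 / cis t - 1) / of_real t) \<longlongrightarrow> - \<i>) (at_right 0)"
    by simp
qed

lemma self_symbol_tendsto:
  assumes "(\<Sum>j\<in>{-2, -1, 1, 2}. \<rho> i j) = -1"
  shows "((\<lambda>t. self_symbol \<rho> i (cis t)) \<longlongrightarrow> - of_real (alpha \<rho> i 1)) (at_right 0)"
proof -
  have "isCont (\<lambda>t. self_symbol \<rho> i (cis t)) 0"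
    unfolding self_symbol_def cis_conv_exp by (intro continuous_intros) auto
  then have "((\<lambda>t. self_symbol \<rho> i (cis t)) \<longlongrightarrow> self_symbol \<rho> i (cis 0)) (at_right 0)"
    unfolding isCont_def by (rule tendsto_within_subset) simp
  then show ?thesis using symbols_at_1(1)[of \<rho> i, OF assms] by simp
qed

text \<open>At angle zero the rows of the symbol matrix are \<open>(- A1, A1)\<close> and
  \<open>(A2, - A2)\<close>, so the determinant vanishes there and the limit is its
  derivative.\<close>

lemma mixed_det_asymptotics:
  assumes sums: "(\<Sum>j\<in>{-2, -1, 1, 2}. \<sigma> 1 j) = -1" "(\<Sum>j\<in>{-2, -1, 1, 2}. \<tau> 2 j) = -1"
  shows "((\<lambda>t. mixed_det \<sigma> \<tau> (cis t) / of_real t) \<longlongrightarrow>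
     - \<i> / 2 * of_real (alpha \<tau> 2 1 * (beta \<sigma> 1 1 + 2 * beta \<sigma> 1 2)
                   + alpha \<sigma> 1 1 * (beta \<tau> 2 1 + 2 * beta \<tau> 2 2))) (at_right 0)"
    (is "(_ \<longlongrightarrow> ?L) _")
proof -
  define d e where "d = (\<lambda>t. (cis t - 1) / of_real t)" and "e = (\<lambda>t. (1 / cis t - 1) / of_real t)"
  define A1 A2 where "A1 = complex_of_real (alpha \<sigma> 1 1)" and "A2 = complex_of_real (alpha \<tau> 2 1)"
  \<comment> \<open>Difference quotients of the four symbols; \<open>?R\<close> consists of the
    first-order terms of the determinant and \<open>t\<close> times the second-order ones.\<close>
  define x1 x2 y1 y2 where
    "x1 = (\<lambda>t. of_real (\<sigma> 1 2) * d t + of_real (\<sigma> 1 (-2)) * e t)"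
    "x2 = (\<lambda>t. of_real (\<tau> 2 2) * d t + of_real (\<tau> 2 (-2)) * e t)"
    "y1 = (\<lambda>t. of_real (\<sigma> 1 (-1)) * e t)" "y2 = (\<lambda>t. of_real (\<tau> 2 1) * d t)"
  note xy = this
  let ?R = "\<lambda>t. - A1 * x2 t - A2 * x1 t - A1 * y2 t - A2 * y1 t + of_real t * (x1 t * x2 t - y1 t * y2 t)"
  have de: "(d \<longlongrightarrow> \<i>) (at_right 0)" "(e \<longlongrightarrow> - \<i>) (at_right 0)"
    using cis_difference_quotient by (simp_all add: d_def e_def)
  have t0: "((\<lambda>t. complex_of_real t) \<longlongrightarrow> of_real 0) (at_right 0)"
    by (intro tendsto_intros)
  have lim: "(?R \<longlongrightarrow> - A1 * (of_real (\<tau> 2 2) * \<i> + of_real (\<tau> 2 (-2)) * - \<i>)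
      - A2 * (of_real (\<sigma> 1 2) * \<i> + of_real (\<sigma> 1 (-2)) * - \<i>)
      - A1 * (of_real (\<tau> 2 1) * \<i>) - A2 * (of_real (\<sigma> 1 (-1)) * - \<i>) + of_real 0 * z) (at_right 0)"
    if "z = (of_real (\<sigma> 1 2) * \<i> + of_real (\<sigma> 1 (-2)) * - \<i>) * (of_real (\<tau> 2 2) * \<i> + of_real (\<tau> 2 (-2)) * - \<i>)
       - (of_real (\<sigma> 1 (-1)) * - \<i>) * (of_real (\<tau> 2 1) * \<i>)" for z
    unfolding xy that by (intro tendsto_intros de t0)
  \<comment> \<open>The one-sided cross terms become symmetric once \<open>A1\<close> and
    \<open>A2\<close> are expanded: \<open>A1 * \<tau> 2 1 - A2 * \<sigma> 1 (-1)\<close> is half of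
    \<open>A2 * beta \<sigma> 1 1 + A1 * beta \<tau> 2 1\<close>.\<close>
  have L: "- A1 * (of_real (\<tau> 2 2) * \<i> + of_real (\<tau> 2 (-2)) * - \<i>)
      - A2 * (of_real (\<sigma> 1 2) * \<i> + of_real (\<sigma> 1 (-2)) * - \<i>)
      - A1 * (of_real (\<tau> 2 1) * \<i>) - A2 * (of_real (\<sigma> 1 (-1)) * - \<i>) + of_real 0 * z = ?L" for z
    by (simp add: A1_def A2_def alpha_def beta_def complex_eq_iff algebra_simps)
  have "(?R \<longlongrightarrow> ?L) (at_right 0)" using lim[OF refl] unfolding L .
  moreover have "\<forall>\<^sub>F t in at_right 0. ?R t = mixed_det \<sigma> \<tau> (cis t) / of_real t"
  proof (rule eventually_mono[OF eventually_at_right_less])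
    fix t :: real assume t: "0 < t"
    have c: "cis t = 1 + of_real t * d t" and c': "x / cis t = x * (1 + of_real t * e t)" for x
      using t by (simp_all add: d_def e_def)
    have "1 + \<sigma> 1 2 + \<sigma> 1 (-2) = - alpha \<sigma> 1 1" "1 + \<tau> 2 2 + \<tau> 2 (-2) = - alpha \<tau> 2 1"
      using sums unfolding sum_neighbours alpha_def by linarith+
    then have one: "1 + complex_of_real (\<sigma> 1 2) + of_real (\<sigma> 1 (-2)) = - A1"
      "1 + complex_of_real (\<tau> 2 2) + of_real (\<tau> 2 (-2)) = - A2"
      unfolding A1_def A2_def by (simp_all flip: of_real_minus add: complex_eq_iff)
    have "self_symbol \<sigma> 1 (cis t) = (1 + of_real (\<sigma> 1 2) + of_real (\<sigma> 1 (-2))) + of_real t * x1 t"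
      "self_symbol \<tau> 2 (cis t) = (1 + of_real (\<tau> 2 2) + of_real (\<tau> 2 (-2))) + of_real t * x2 t"
      unfolding self_symbol_def c' xy by (simp_all add: c algebra_simps)
    moreover have "cross_symbol1 \<sigma> (cis t) = A1 + of_real t * y1 t"
      unfolding cross_symbol1_def c' xy by (simp add: A1_def alpha_def algebra_simps)
    moreover have "cross_symbol2 \<tau> (cis t) = A2 + of_real t * y2 t"
      unfolding cross_symbol2_def xy by (simp add: A2_def alpha_def c algebra_simps)
    ultimately have "mixed_det \<sigma> \<tau> (cis t)
      = (- A1 + of_real t * x1 t) * (- A2 + of_real t * x2 t) - (A1 + of_real t * y1 t) * (A2 + of_real t * y2 t)"
      by (simp only: mixed_det_def one)
    also have "\<dots> = of_real t * ?R t" by (simp add: algebra_simps)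
    finally show "?R t = mixed_det \<sigma> \<tau> (cis t) / of_real t" using t by simp
  qed
  ultimately show ?thesis by (rule Lim_transform_eventually)
qed

text \<open>If no root of the mode polynomial lay in the right half-plane, \<open>log_pderiv_bound\<close> at the leading-order
  approximation \<open>sqrt t * \<mu>\<close> of a small root would bound the derivative, of order \<open>sqrt t\<close>, by the value
  divided by \<open>sqrt t\<close>, of smaller order. In the proof, \<open>t * R t\<close> is the value and \<open>sqrt t * D t\<close> the derivative.\<close>

lemma mode_poly_unstable_root_near_1:
  fixes gx gv :: "nat \<Rightarrow> real" and \<rho>x \<rho>v :: "nat \<Rightarrow> int \<Rightarrow> real"
  assumes sum_x: "\<And>i. i \<in> {1, 2} \<Longrightarrow> (\<Sum>j\<in>{-2, -1, 1, 2}. \<rho>x i j) = -1"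
    and sum_v: "\<And>i. i \<in> {1, 2} \<Longrightarrow> (\<Sum>j\<in>{-2, -1, 1, 2}. \<rho>v i j) = -1"
    and K: "gx 1 * gx 2 * (alpha \<rho>x 2 1 * (beta \<rho>x 1 1 + 2 * beta \<rho>x 1 2)
                        + alpha \<rho>x 1 1 * (beta \<rho>x 2 1 + 2 * beta \<rho>x 2 2)) \<noteq> 0" (is "?K \<noteq> 0")
    and P: "gx 1 * alpha \<rho>x 1 1 + gx 2 * alpha \<rho>x 2 1 \<noteq> 0" (is "?P \<noteq> 0")
  shows "\<forall>\<^sub>F t in at_right 0. \<exists>\<nu>. poly (mode_poly gx gv \<rho>x \<rho>v (cis t)) \<nu> = 0 \<and> 0 < Re \<nu>"
proof -
  have sums: "(\<Sum>j\<in>{-2, -1, 1, 2}. \<rho>x 1 j) = -1" "(\<Sum>j\<in>{-2, -1, 1, 2}. \<rho>x 2 j) = -1"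
    "(\<Sum>j\<in>{-2, -1, 1, 2}. \<rho>v 1 j) = -1" "(\<Sum>j\<in>{-2, -1, 1, 2}. \<rho>v 2 j) = -1"
    by (rule sum_x sum_v, simp)+
  define c0 c1 c2 c3 where
    "c0 = (\<lambda>t. of_real (gx 1 * gx 2) * mixed_det \<rho>x \<rho>x (cis t))"
    "c1 = (\<lambda>t. of_real (gx 1 * gv 2) * mixed_det \<rho>x \<rho>v (cis t)
        + of_real (gv 1 * gx 2) * mixed_det \<rho>v \<rho>x (cis t))"
    "c2 = (\<lambda>t. of_real (gv 1 * gv 2) * mixed_det \<rho>v \<rho>v (cis t)
         - of_real (gx 1) * self_symbol \<rho>x 1 (cis t) - of_real (gx 2) * self_symbol \<rho>x 2 (cis t))"
    "c3 = (\<lambda>t. - of_real (gv 1) * self_symbol \<rho>v 1 (cis t) - of_real (gv 2) * self_symbol \<rho>v 2 (cis t))"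
  note c_defs = this
  \<comment> \<open>\<open>l0\<close> is the limit of \<open>c0 t / t\<close>, and
    \<open>\<mu>\<close> is chosen so that the leading terms \<open>l0\<close> and
    \<open>P * \<mu> ^ 2\<close> cancel.\<close>
  define l0 where "l0 = - \<i> / 2 * of_real ?K"
  define \<mu> where "\<mu> = csqrt (- l0 / of_real ?P)"
  have \<mu>2: "\<mu> ^ 2 = - l0 / of_real ?P" by (simp add: \<mu>_def)
  \<comment> \<open>The square of \<open>\<mu>\<close> is purely imaginary and nonzero, so its
    principal square root cannot lie on the imaginary axis.\<close>
  have "0 < Re \<mu>"
  proof (rule ccontr)
    assume "\<not> 0 < Re \<mu>"
    then have "Re \<mu> = 0" using csqrt_principal[of "- l0 / of_real ?P", folded \<mu>_def] by auto
    then have "Im (\<mu> ^ 2) = 0" by (simp add: power2_eq_square)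
    then show False using K P unfolding \<mu>2 l0_def by simp
  qed
  then have "\<mu> \<noteq> 0" by auto
  have t0: "((\<lambda>t. complex_of_real t) \<longlongrightarrow> 0) (at_right 0)"
    by (rule tendsto_eq_intros) auto
  have s0: "((\<lambda>t. complex_of_real (sqrt t)) \<longlongrightarrow> 0) (at_right 0)"
  proof -
    have "((\<lambda>t. complex_of_real (sqrt t)) \<longlongrightarrow> of_real (sqrt 0)) (at_right 0)"
      by (intro tendsto_intros)
    then show ?thesis by simp
  qed
  note dets = mixed_det_asymptotics[of \<rho>x \<rho>x, OF sums(1,2)] mixed_det_asymptotics[of \<rho>x \<rho>v, OF sums(1,4)]
    mixed_det_asymptotics[of \<rho>v \<rho>x, OF sums(3,2)] mixed_det_asymptotics[of \<rho>v \<rho>v, OF sums(3,4)]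
  have c0: "((\<lambda>t. c0 t / of_real t) \<longlongrightarrow> l0) (at_right 0)"
    using tendsto_mult[OF tendsto_const[of "complex_of_real (gx 1 * gx 2)"] dets(1)]
    by (simp add: c_defs l0_def mult_ac)
  obtain l1 where c1: "((\<lambda>t. c1 t / of_real t) \<longlongrightarrow> l1) (at_right 0)"
    using tendsto_add[OF tendsto_mult[OF tendsto_const[of "complex_of_real (gx 1 * gv 2)"] dets(2)]
        tendsto_mult[OF tendsto_const[of "complex_of_real (gv 1 * gx 2)"] dets(3)]]
    unfolding c_defs add_divide_distrib times_divide_eq_right by blast
  \<comment> \<open>A mixed determinant is of order \<open>t\<close>, so in the limit
    \<open>c2\<close> retains only its self symbols, which sum to \<open>P\<close>.\<close>
  have "((\<lambda>t. of_real t * (mixed_det \<rho>v \<rho>v (cis t) / of_real t)) \<longlongrightarrow> 0) (at_right 0)"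
    using tendsto_mult[OF t0 dets(4)] by simp
  then have "((\<lambda>t. mixed_det \<rho>v \<rho>v (cis t)) \<longlongrightarrow> 0) (at_right 0)"
    by (rule Lim_transform_eventually) (rule eventually_mono[OF eventually_at_right_less], simp)
  then have "(c2 \<longlongrightarrow> of_real (gv 1 * gv 2) * 0 - of_real (gx 1) * - of_real (alpha \<rho>x 1 1)
      - of_real (gx 2) * - of_real (alpha \<rho>x 2 1)) (at_right 0)"
    unfolding c_defs by (intro tendsto_intros self_symbol_tendsto sums)
  then have c2: "(c2 \<longlongrightarrow> of_real ?P) (at_right 0)" by simp
  obtain l3 where c3: "(c3 \<longlongrightarrow> l3) (at_right 0)"
  proof
    show "(c3 \<longlongrightarrow> - of_real (gv 1) * - of_real (alpha \<rho>v 1 1) - of_real (gv 2) * - of_real (alpha \<rho>v 2 1)) (at_right 0)"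
      unfolding c_defs by (intro tendsto_intros self_symbol_tendsto sums)
  qed
  define R D where
    "R = (\<lambda>t. c0 t / of_real t + of_real (sqrt t) * (c1 t / of_real t) * \<mu> + c2 t * \<mu> ^ 2
       + of_real (sqrt t) * c3 t * \<mu> ^ 3 + of_real t * \<mu> ^ 4)"
    "D = (\<lambda>t. of_real (sqrt t) * (c1 t / of_real t) + 2 * c2 t * \<mu>
       + 3 * of_real (sqrt t) * c3 t * \<mu> ^ 2 + 4 * of_real t * \<mu> ^ 3)"
  note RD = this
  have "(R \<longlongrightarrow> l0 + 0 * l1 * \<mu> + of_real ?P * \<mu> ^ 2 + 0 * l3 * \<mu> ^ 3 + 0 * \<mu> ^ 4) (at_right 0)"
    unfolding RD by (intro tendsto_intros c0 c1 c2 c3 s0 t0)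
  moreover have "l0 + 0 * l1 * \<mu> + of_real ?P * \<mu> ^ 2 + 0 * l3 * \<mu> ^ 3 + 0 * \<mu> ^ 4 = 0"
    using P unfolding \<mu>2 by (simp flip: of_real_add of_real_mult)
  ultimately have R: "(R \<longlongrightarrow> 0) (at_right 0)" by simp
  have D: "(D \<longlongrightarrow> 0 * l1 + 2 * of_real ?P * \<mu> + 3 * 0 * l3 * \<mu> ^ 2 + 4 * 0 * \<mu> ^ 3) (at_right 0)"
    unfolding RD by (intro tendsto_intros c0 c1 c2 c3 s0 t0)
  \<comment> \<open>\<open>R\<close> tends to 0 while \<open>D\<close> tends to
    \<open>2 * P * \<mu>\<close>, so the limit is positive. The factor 4 is the degree of the
    quartic.\<close>
  have "((\<lambda>t. Re \<mu> * cmod (D t) - 4 * cmod (R t)) \<longlongrightarrow>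
      Re \<mu> * cmod (0 * l1 + 2 * of_real ?P * \<mu> + 3 * 0 * l3 * \<mu> ^ 2 + 4 * 0 * \<mu> ^ 3) - 4 * cmod 0)
      (at_right 0)"
    by (intro tendsto_intros R D)
  moreover have "0 < Re \<mu> * cmod (0 * l1 + 2 * of_real ?P * \<mu> + 3 * 0 * l3 * \<mu> ^ 2 + 4 * 0 * \<mu> ^ 3) - 4 * cmod 0"
    using \<open>0 < Re \<mu>\<close> \<open>\<mu> \<noteq> 0\<close> P by (simp flip: of_real_add of_real_mult)
  ultimately have "\<forall>\<^sub>F t in at_right 0. 0 < Re \<mu> * cmod (D t) - 4 * cmod (R t)"
    by (rule order_tendstoD(1))
  then show ?thesis
    using eventually_at_right_less[of 0]
  proof eventually_elim
    case (elim t)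
    let ?s = "complex_of_real (sqrt t)"
    let ?f = "mode_poly gx gv \<rho>x \<rho>v (cis t)"
    have f: "?f = [:c0 t, c1 t, c2 t, c3 t, 1:]" by (simp only: mode_poly_coeffs c_defs)
    have st: "complex_of_real t = ?s * ?s" and s: "?s \<noteq> 0"
      using elim(2) by (simp_all flip: of_real_mult)
    have f0: "poly ?f (?s * \<mu>) = of_real t * R t"
      using s unfolding RD st f by (simp add: field_simps power2_eq_square power3_eq_cube power4_eq_xxxx)
    have f1: "poly (pderiv ?f) (?s * \<mu>) = ?s * D t"
      using s unfolding RD st f
      by (simp add: pderiv_pCons field_simps power2_eq_square power3_eq_cube power4_eq_xxxx)
    show ?case
    proof (rule ccontr)
      assume "\<nexists>\<nu>. poly ?f \<nu> = 0 \<and> 0 < Re \<nu>"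
      then have roots: "Re \<nu> \<le> 0" if "poly ?f \<nu> = 0" for \<nu> using that not_less by blast
      have f_nz: "?f \<noteq> 0" and deg: "degree ?f = 4" by (simp_all add: f)
      have "0 < Re (?s * \<mu>)" using elim(2) \<open>0 < Re \<mu>\<close> by simp
      from log_pderiv_bound[OF f_nz roots this]
      have "Re (?s * \<mu>) * cmod (?s * D t) \<le> real 4 * cmod (of_real t * R t)"
        by (simp only: f0 f1 deg)
      \<comment> \<open>Each side of the bound carries exactly one factor \<open>t\<close>, here as
        the product of two factors \<open>sqrt t\<close>; cancelling it contradicts the eventual
        inequality between \<open>D\<close> and \<open>R\<close>.\<close>
      also have "Re (?s * \<mu>) * cmod (?s * D t) = t * (Re \<mu> * cmod (D t))"
        using elim(2) by (simp add: norm_mult)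
      finally have "t * (Re \<mu> * cmod (D t)) \<le> t * (4 * cmod (R t))"
        using elim(2) by (simp add: norm_mult)
      then show False using elim by simp
    qed
  qed
qed

section \<open>Combination of the three conditions\<close>

theorem theorem3p1:
  fixes gx gv :: "nat \<Rightarrow> real" and \<rho>x \<rho>v :: "nat \<Rightarrow> int \<Rightarrow> real"
  assumes sum_x: "\<And>i. i \<in> {1, 2} \<Longrightarrow> (\<Sum>j\<in>{-2, -1, 1, 2}. \<rho>x i j) = -1"
    and sum_v: "\<And>i. i \<in> {1, 2} \<Longrightarrow> (\<Sum>j\<in>{-2, -1, 1, 2}. \<rho>v i j) = -1"
    and cond:
      "(gx 1 = 0 \<or> gx 2 = 0)
       \<or> (gx 1 * alpha \<rho>x 1 1 + gx 2 * alpha \<rho>x 2 1 \<le> 0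
          \<or> gv 1 * alpha \<rho>v 1 1 + gv 2 * alpha \<rho>v 2 1 \<le> 0)
       \<or> gx 1 * gx 2 * (alpha \<rho>x 2 1 * (beta \<rho>x 1 1 + 2 * beta \<rho>x 1 2)
                        + alpha \<rho>x 1 1 * (beta \<rho>x 2 1 + 2 * beta \<rho>x 2 2)) \<noteq> 0"
  shows "\<exists>n0. \<forall>n\<ge>n0. \<not> linearly_stable (system_matrix gx gv \<rho>x \<rho>v n)"
proof -
  let ?P = "gx 1 * alpha \<rho>x 1 1 + gx 2 * alpha \<rho>x 2 1"
  \<comment> \<open>The third case may assume \<open>?P \<noteq> 0\<close>, because a vanishing
    \<open>?P\<close> belongs to the second.\<close>
  consider "gx 1 = 0 \<or> gx 2 = 0" | "?P \<le> 0 \<or> gv 1 * alpha \<rho>v 1 1 + gv 2 * alpha \<rho>v 2 1 \<le> 0"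
    | "?P \<noteq> 0" "gx 1 * gx 2 * (alpha \<rho>x 2 1 * (beta \<rho>x 1 1 + 2 * beta \<rho>x 1 2)
                        + alpha \<rho>x 1 1 * (beta \<rho>x 2 1 + 2 * beta \<rho>x 2 2)) \<noteq> 0"
    using cond by linarith
  then show ?thesis
  proof cases
    case 1
    then have "\<not> linearly_stable (system_matrix gx gv \<rho>x \<rho>v n)" if "n \<ge> 3" for n
      using that by (intro not_stable_if_uncoupled sum_x sum_v) auto
    then show ?thesis by blast
  next
    case 2
    then have "\<not> linearly_stable (system_matrix gx gv \<rho>x \<rho>v n)" if "n \<ge> 1" for n
      using that by (intro not_stable_if_nonpos sum_x sum_v) auto
    then show ?thesis by blast
  next
    case 3
    \<comment> \<open>The angle of the root of unity \<open>cis (2 * pi / n)\<close> tends to 0 from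
      the right, which transfers the statement about small \<open>t\<close> to large
      \<open>n\<close>.\<close>
    have "(\<lambda>n. 2 * pi / real n) \<longlonglongrightarrow> 0" by (rule lim_const_over_n)
    moreover have pos: "\<forall>\<^sub>F n in sequentially. 0 < 2 * pi / real n"
      using eventually_gt_at_top[of 0] by eventually_elim simp
    ultimately have "filterlim (\<lambda>n. 2 * pi / real n) (at_right 0) sequentially"
      by (rule tendsto_imp_filterlim_at_right)
    moreover have "\<forall>\<^sub>F t in at_right 0. \<exists>\<nu>. poly (mode_poly gx gv \<rho>x \<rho>v (cis t)) \<nu> = 0 \<and> 0 < Re \<nu>"
      by (intro mode_poly_unstable_root_near_1 sum_x sum_v 3)
    ultimately have "\<forall>\<^sub>F n in sequentially.
        \<exists>\<nu>. poly (mode_poly gx gv \<rho>x \<rho>v (cis (2 * pi / real n))) \<nu> = 0 \<and> 0 < Re \<nu>"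
      by (rule eventually_compose_filterlim[rotated])
    then have "\<forall>\<^sub>F n in sequentially. \<not> linearly_stable (system_matrix gx gv \<rho>x \<rho>v n)"
      using pos
    proof eventually_elim
      case (elim n)
      then have "0 < n" by (simp add: zero_less_divide_iff)
      moreover from this have "cis (2 * pi / n) ^ n = 1" by (simp add: DeMoivre)
      ultimately show ?case
        using elim(1) linearly_stable_mode_poly_root[of gx gv \<rho>x \<rho>v n "cis (2 * pi / n)"] by force
    qed
    then show ?thesis by (simp add: eventually_sequentially)
  qed
qed

end
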